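(* Let $\Bbbk$ be an algebraically closed field of characteristic $0$, let $\Sigma\subset\mathbb{R}^d$ be a rational polyhedral fan of pointed cones, let $\mathscr{M}=\{M_\sigma\mid\sigma\in\Sigma\}$ be a monoidal complex supported on $\Sigma$ with toric face ring $\Bbbk[\mathscr{M}]$, and let $\mathscr{F}(\Sigma)$ be the set of facets (inclusion-maximal cones) of $\Sigma$. Let $\sigma\in\mathscr{F}(\Sigma)$ and let $\rho\in D^i(\Bbbk[M_\sigma])$ be homogeneous of degree $\boldsymbol{b}\in\mathbb{Z}\sigma$, where $\mathbb{Z}\sigma$ is the abelian group generated by $M_\sigma$. Suppose that for every $\tau\in\mathscr{F}(\Sigma)\setminus\{\sigma\}$ and every $f\in\Bbbk[M_\sigma]\subset\Bbbk[\mathscr{M}]$ with $\pi_\tau(f)=0$ one has $\pi_{\sigma,\sigma\cap\tau}(\rho(f))=0$. Then $\rho=t^{\boldsymbol{b}}q(\theta)$ for some $q\in\Bbbk[\theta]=\Bbbk[\theta_1,\dots,\theta_d]$ such that (i) for $\boldsymbol{a}\in M_\sigma$, $q(\boldsymbol{a})=0$ if $\boldsymbol{a}+\boldsymbol{b}\notin M_\sigma$; and (ii) for every $\tau\in\mathscr{F}(\Sigma)\setminus\{\sigma\}$ and every $\boldsymbol{a}\in M_\sigma\setminus M_{\sigma\cap\tau}$ such that $\boldsymbol{a}+\boldsymbol{b}\in M_{\sigma\cap\tau}$, we have $q(\boldsymbol{a})=0$.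
   Context: Monoidal complex: a collection of finitely generated monoids $\{M_\sigma\mid\sigma\in\Sigma\}$ such that $M_\tau\subseteq\tau\cap\mathbb{Z}^d$ and $\mathbb{R}_{\ge0}M_\tau=\tau$ for all $\tau\in\Sigma$, and $M_\sigma=\sigma\cap M_\tau$ whenever $\sigma\subseteq\tau$ are in $\Sigma$. Put $|\mathscr{M}|=\bigcup_{\tau\in\Sigma}M_\tau$. The toric face ring is $\Bbbk[\mathscr{M}]=\bigoplus_{\boldsymbol{a}\in|\mathscr{M}|}\Bbbk\cdot t^{\boldsymbol{a}}$ with $t^{\boldsymbol{a}}\cdot t^{\boldsymbol{c}}=t^{\boldsymbol{a}+\boldsymbol{c}}$ if some $\tau\in\Sigma$ contains both $\boldsymbol{a}$ and $\boldsymbol{c}$, and $0$ otherwise. For $\tau\in\Sigma$, $\Bbbk[M_\tau]=\bigoplus_{\boldsymbol{a}\in M_\tau}\Bbbk t^{\boldsymbol{a}}$ is the semigroup ring, a subring of $\Bbbk[\mathscr{M}]$; $\pi_\tau\colon\Bbbk[\mathscr{M}]\to\Bbbk[M_\tau]$ is the ring surjection sending $t^{\boldsymbol{a}}$ to $t^{\boldsymbol{a}}$ if $\boldsymbol{a}\in M_\tau$ and to $0$ otherwise. For $\sigma,\tau\in\Sigma$, $\pi_{\sigma,\sigma\cap\tau}\colon\Bbbk[M_\sigma]\to\Bbbk[M_{\sigma\cap\tau}]$ is the analogous projection. Differential operators: for a commutative $\Bbbk$-algebra $S$, $D^0(S)=\mathrm{Hom}_S(S,S)$ and for $i>0$, $D^i(S)=\{\delta\in\mathrm{Hom}_\Bbbk(S,S)\mid[\delta,s]\in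 D^{i-1}(S)\ \forall s\in S\}$. An operator $\rho$ on $\Bbbk[M_\sigma]$ is homogeneous of degree $\boldsymbol{b}$ if it sends each monomial $t^{\boldsymbol{a}}$ to a (possibly zero) scalar multiple of $t^{\boldsymbol{a}+\boldsymbol{b}}$ (being zero if $\boldsymbol{a}+\boldsymbol{b}\notin M_\sigma$). Here $\theta_j=t_j\partial_j$, where $\partial_j=\partial/\partial t_j$, are commuting operators with $\theta_j(t^{\boldsymbol{a}})=a_jt^{\boldsymbol{a}}$, so that $t^{\boldsymbol{b}}q(\theta)$ sends $t^{\boldsymbol{a}}$ to $q(\boldsymbol{a})t^{\boldsymbol{a}+\boldsymbol{b}}$. *)

theory Defs
  imports
    "HOL-Analysis.Polytope"
    "HOL-Computational_Algebra.Polynomial"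
    "HOL-Computational_Algebra.Group_Closure"
    "HOL-Library.Poly_Mapping"
    "HOL-Library.FuncSet"
    "HOL-Algebra.Module"
begin

section \<open>Fans\<close>

text \<open>
  Lattice points are elements of \<^typ>\<open>int ^ 'n\<close>, and \<open>rvec\<close> is the embedding of
  the lattice into the ambient space \<^typ>\<open>real ^ 'n\<close>.
\<close>

definition rvec :: "int ^ 'n \<Rightarrow> real ^ 'n"
  where "rvec a = (\<chi> j. of_int (a $ j))"

definition rational_polyhedral_cone :: "(real ^ 'n) set \<Rightarrow> bool"
  where "rational_polyhedral_cone \<tau> \<longleftrightarrow>
    (\<exists>G :: (int ^ 'n) set. finite G \<and> \<tau> = convex_cone hull (rvec ` G))"

definition pointed :: "'a::real_vector set \<Rightarrow> bool"
  where "pointed \<tau> \<longleftrightarrow> \<tau> \<inter> uminus ` \<tau> = {0}"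

text \<open>
  The empty set is a face in the sense of \<^const>\<open>face_of\<close> but not a face of a cone,
  so it is excluded.  For polyhedral cones the nonempty faces in the sense of
  \<^const>\<open>face_of\<close> are the cone itself and its
  intersections with supporting hyperplanes.
\<close>

definition cone_face :: "'a::real_vector set \<Rightarrow> 'a set \<Rightarrow> bool"
  where "cone_face \<upsilon> \<tau> \<longleftrightarrow> \<upsilon> face_of \<tau> \<and> \<upsilon> \<noteq> {}"

definition rational_pointed_fan :: "(real ^ 'n) set set \<Rightarrow> bool"
  where "rational_pointed_fan \<Sigma> \<longleftrightarrow>
    finite \<Sigma> \<and>
    (\<forall>\<tau>\<in>\<Sigma>. rational_polyhedral_cone \<tau> \<and> pointed \<tau>) \<and>
    (\<forall>\<tau>\<in>\<Sigma>. \<forall>\<upsilon>. cone_face \<upsilon> \<tau> \<longrightarrow> \<upsilon> \<in> \<Sigma>) \<and>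
    (\<forall>\<sigma>\<in>\<Sigma>. \<forall>\<tau>\<in>\<Sigma>. cone_face (\<sigma> \<inter> \<tau>) \<sigma> \<and> cone_face (\<sigma> \<inter> \<tau>) \<tau>)"

definition facets :: "'a set set \<Rightarrow> 'a set set"
  where "facets \<Sigma> = {\<sigma> \<in> \<Sigma>. \<forall>\<tau>\<in>\<Sigma>. \<sigma> \<subseteq> \<tau> \<longrightarrow> \<tau> = \<sigma>}"


section \<open>Monoidal complexes\<close>

definition add_submonoid :: "'a::comm_monoid_add set \<Rightarrow> bool"
  where "add_submonoid A \<longleftrightarrow> 0 \<in> A \<and> (\<forall>x\<in>A. \<forall>y\<in>A. x + y \<in> A)"

definition fin_gen_monoid :: "'a::comm_monoid_add set \<Rightarrow> bool"
  where "fin_gen_monoid A \<longleftrightarrow> (\<exists>G. finite G \<and> A = add_submonoid hull G)"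

definition monoidal_complex :: "(real ^ 'n) set set \<Rightarrow> ((real ^ 'n) set \<Rightarrow> (int ^ 'n) set) \<Rightarrow> bool"
  where "monoidal_complex \<Sigma> M \<longleftrightarrow>
    (\<forall>\<tau>\<in>\<Sigma>. fin_gen_monoid (M \<tau>) \<and> rvec ` M \<tau> \<subseteq> \<tau> \<and> convex_cone hull (rvec ` M \<tau>) = \<tau>) \<and>
    (\<forall>\<sigma>\<in>\<Sigma>. \<forall>\<tau>\<in>\<Sigma>. \<sigma> \<subseteq> \<tau> \<longrightarrow> M \<sigma> = {a \<in> M \<tau>. rvec a \<in> \<sigma>})"

definition monoid_support ::
  "(real ^ 'n) set set \<Rightarrow> ((real ^ 'n) set \<Rightarrow> (int ^ 'n) set) \<Rightarrow> (int ^ 'n) set"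
  where "monoid_support \<Sigma> M = (\<Union>\<tau>\<in>\<Sigma>. M \<tau>)"


section \<open>Semigroup rings and toric face rings\<close>

text \<open>
  A Laurent polynomial is a finitely supported map from exponents to coefficients, with the
  convolution product of \<^theory>\<open>HOL-Library.Poly_Mapping\<close>.  Both kinds of rings below
  are algebras on sets of such maps; the scalars range over the whole type \<open>'k\<close>.
\<close>

type_synonym ('n, 'k) laurent = "(int ^ 'n) \<Rightarrow>\<^sub>0 'k"

abbreviation tpow :: "int ^ 'n \<Rightarrow> ('n, 'k::zero_neq_one) laurent"
  where "tpow a \<equiv> Poly_Mapping.single a 1"

definition scale :: "'k::semiring_0 \<Rightarrow> ('a \<Rightarrow>\<^sub>0 'k) \<Rightarrow> ('a \<Rightarrow>\<^sub>0 'k)"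
  where "scale c f = Poly_Mapping.map ((*) c) f"

definition semigroup_algebra :: "(int ^ 'n) set \<Rightarrow> ('k::field, ('n, 'k) laurent) module"
  where "semigroup_algebra A =
    \<lparr>carrier = {f. Poly_Mapping.keys f \<subseteq> A}, mult = (*), one = 1, zero = 0, add = (+),
     smult = scale\<rparr>"

definition toric_mult ::
  "(real ^ 'n) set set \<Rightarrow> ('n, 'k::field) laurent \<Rightarrow> ('n, 'k) laurent \<Rightarrow> ('n, 'k) laurent"
  where "toric_mult \<Sigma> f g =
    (\<Sum>a\<in>Poly_Mapping.keys f. \<Sum>c\<in>Poly_Mapping.keys g.
      if \<exists>\<tau>\<in>\<Sigma>. rvec a \<in> \<tau> \<and> rvec c \<in> \<tau>
      then Poly_Mapping.single (a + c) (Poly_Mapping.lookup f a * Poly_Mapping.lookup g c)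
      else 0)"

definition toric_face_algebra ::
  "(real ^ 'n) set set \<Rightarrow> ((real ^ 'n) set \<Rightarrow> (int ^ 'n) set) \<Rightarrow> ('k::field, ('n, 'k) laurent) module"
  where "toric_face_algebra \<Sigma> M =
    \<lparr>carrier = {f. Poly_Mapping.keys f \<subseteq> monoid_support \<Sigma> M}, mult = toric_mult \<Sigma>, one = 1,
     zero = 0, add = (+), smult = scale\<rparr>"

lemma semigroup_algebra_subset_toric_face_algebra:
  "\<tau> \<in> \<Sigma> \<Longrightarrow> carrier (semigroup_algebra (M \<tau>)) \<subseteq> carrier (toric_face_algebra \<Sigma> M)"
  by (auto simp: semigroup_algebra_def toric_face_algebra_def monoid_support_def)

lemma cring_semigroup_algebra:
  assumes "add_submonoid A"
  shows "cring (semigroup_algebra A :: ('k::field, ('n::finite, 'k) laurent) module)"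
proof (intro cringI abelian_groupI comm_monoidI)
  let ?S = "semigroup_algebra A :: ('k, ('n, 'k) laurent) module"
  show "f \<otimes>\<^bsub>?S\<^esub> g \<in> carrier ?S" if "f \<in> carrier ?S" "g \<in> carrier ?S" for f g
  proof -
    have "Poly_Mapping.keys (f * g) \<subseteq> A"
      using that assms keys_mult[of f g]
      unfolding semigroup_algebra_def add_submonoid_def partial_object.simps mem_Collect_eq by blast
    then show ?thesis
      by (simp add: semigroup_algebra_def)
  qed
  show "f \<oplus>\<^bsub>?S\<^esub> g \<in> carrier ?S" if "f \<in> carrier ?S" "g \<in> carrier ?S" for f g
    using that Poly_Mapping.keys_add[of f g] by (simp add: semigroup_algebra_def) blast
  show "\<exists>g\<in>carrier ?S. g \<oplus>\<^bsub>?S\<^esub> f = \<zero>\<^bsub>?S\<^esub>" if "f \<in> carrier ?S" for f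
    using that by (intro bexI[of _ "- f"]) (auto simp: semigroup_algebra_def)
qed (use assms in \<open>auto simp: semigroup_algebra_def add_submonoid_def algebra_simps\<close>)

lemma semigroup_algebra_minus:
  fixes f g :: "('n::finite, 'k::field) laurent"
  assumes "add_submonoid A" "f \<in> carrier (semigroup_algebra A)" "g \<in> carrier (semigroup_algebra A)"
  shows "f \<ominus>\<^bsub>semigroup_algebra A\<^esub> g = f - g"
proof -
  interpret cring "semigroup_algebra A :: ('k, ('n, 'k) laurent) module"
    by (rule cring_semigroup_algebra) fact
  have "\<ominus>\<^bsub>semigroup_algebra A\<^esub> g = - g"
    using assms(3) by (intro minus_equality) (auto simp: semigroup_algebra_def)
  then show ?thesis
    by (simp only: a_minus_def) (simp add: semigroup_algebra_def)
qed

lemma laurent_expand: "f = (\<Sum>a\<in>Poly_Mapping.keys f. Poly_Mapping.single a (Poly_Mapping.lookup f a))"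
  by (rule poly_mapping_eqI)
    (simp add: lookup_sum lookup_single when_def in_keys_iff)

lemma semigroup_algebra_subring:
  assumes "monoidal_complex \<Sigma> M" "\<tau> \<in> \<Sigma>"
    and "f \<in> carrier (semigroup_algebra (M \<tau>))" "g \<in> carrier (semigroup_algebra (M \<tau>))"
  shows "f \<otimes>\<^bsub>toric_face_algebra \<Sigma> M\<^esub> g = f * g"
proof -
  have "\<exists>\<upsilon>\<in>\<Sigma>. rvec a \<in> \<upsilon> \<and> rvec c \<in> \<upsilon>"
    if "a \<in> Poly_Mapping.keys f" "c \<in> Poly_Mapping.keys g" for a c
    using that assms unfolding monoidal_complex_def semigroup_algebra_def by fastforce
  then have "toric_mult \<Sigma> f g = (\<Sum>a\<in>Poly_Mapping.keys f. \<Sum>c\<in>Poly_Mapping.keys g.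
      Poly_Mapping.single (a + c) (Poly_Mapping.lookup f a * Poly_Mapping.lookup g c))"
    unfolding toric_mult_def by (intro sum.cong) auto
  also have "\<dots> = (\<Sum>a\<in>Poly_Mapping.keys f. Poly_Mapping.single a (Poly_Mapping.lookup f a)) *
      (\<Sum>c\<in>Poly_Mapping.keys g. Poly_Mapping.single c (Poly_Mapping.lookup g c))"
    by (simp add: sum_product mult_single)
  also have "\<dots> = f * g"
    by (simp flip: laurent_expand)
  finally show ?thesis
    by (simp add: toric_face_algebra_def)
qed

text \<open>
  The projections \<open>\<k>[\<M>] \<rightarrow> \<k>[M\<^sub>\<tau>]\<close> and \<open>\<k>[A] \<rightarrow> \<k>[B]\<close> (for \<open>B \<subseteq> A\<close>), as functions
  on the carrier of their source.
\<close>

definition keep :: "'a set \<Rightarrow> ('a \<Rightarrow>\<^sub>0 'k::comm_monoid_add) \<Rightarrow> ('a \<Rightarrow>\<^sub>0 'k)"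
  where "keep B f = (\<Sum>a\<in>Poly_Mapping.keys f \<inter> B. Poly_Mapping.single a (Poly_Mapping.lookup f a))"

definition toric_proj ::
  "(real ^ 'n) set set \<Rightarrow> ((real ^ 'n) set \<Rightarrow> (int ^ 'n) set) \<Rightarrow> (real ^ 'n) set \<Rightarrow>
    ('n, 'k::field) laurent \<Rightarrow> ('n, 'k) laurent"
  where "toric_proj \<Sigma> M \<tau> = (\<lambda>f\<in>carrier (toric_face_algebra \<Sigma> M). keep (M \<tau>) f)"

definition semigroup_proj ::
  "(int ^ 'n) set \<Rightarrow> (int ^ 'n) set \<Rightarrow> ('n, 'k::field) laurent \<Rightarrow> ('n, 'k) laurent"
  where "semigroup_proj A B = (\<lambda>f\<in>carrier (semigroup_algebra A). keep B f)"


section \<open>Differential operators\<close>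

text \<open>
  An operator on a \<open>\<k>\<close>-algebra \<open>S\<close> is represented by a function whose values outside
  \<open>carrier S\<close> are irrelevant: membership below depends only on its restriction to
  \<open>carrier S\<close>.
\<close>

definition additive_on :: "('k, 'a, 'm) module_scheme \<Rightarrow> ('a \<Rightarrow> 'a) \<Rightarrow> bool"
  where "additive_on S \<delta> \<longleftrightarrow> \<delta> \<in> carrier S \<rightarrow> carrier S \<and>
    (\<forall>x\<in>carrier S. \<forall>y\<in>carrier S. \<delta> (x \<oplus>\<^bsub>S\<^esub> y) = \<delta> x \<oplus>\<^bsub>S\<^esub> \<delta> y)"

definition Hom_self :: "('k, 'a, 'm) module_scheme \<Rightarrow> ('a \<Rightarrow> 'a) set"
  where "Hom_self S = {\<delta>. additive_on S \<delta> \<and>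
    (\<forall>s\<in>carrier S. \<forall>x\<in>carrier S. \<delta> (s \<otimes>\<^bsub>S\<^esub> x) = s \<otimes>\<^bsub>S\<^esub> \<delta> x)}"

definition Hom_scalar :: "('k, 'a, 'm) module_scheme \<Rightarrow> ('a \<Rightarrow> 'a) set"
  where "Hom_scalar S = {\<delta>. additive_on S \<delta> \<and>
    (\<forall>c. \<forall>x\<in>carrier S. \<delta> (c \<odot>\<^bsub>S\<^esub> x) = c \<odot>\<^bsub>S\<^esub> \<delta> x)}"

definition commutator :: "('k, 'a, 'm) module_scheme \<Rightarrow> ('a \<Rightarrow> 'a) \<Rightarrow> 'a \<Rightarrow> ('a \<Rightarrow> 'a)"
  where "commutator S \<delta> s = (\<lambda>x. \<delta> (s \<otimes>\<^bsub>S\<^esub> x) \<ominus>\<^bsub>S\<^esub> (s \<otimes>\<^bsub>S\<^esub> \<delta> x))"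

primrec diff_ops :: "('k, 'a, 'm) module_scheme \<Rightarrow> nat \<Rightarrow> ('a \<Rightarrow> 'a) set"
  where
    "diff_ops S 0 = Hom_self S"
  | "diff_ops S (Suc i) = {\<delta> \<in> Hom_scalar S. \<forall>s\<in>carrier S. commutator S \<delta> s \<in> diff_ops S i}"

definition homogeneous_op ::
  "(int ^ 'n) set \<Rightarrow> int ^ 'n \<Rightarrow> (('n, 'k::field) laurent \<Rightarrow> ('n, 'k) laurent) \<Rightarrow> bool"
  where "homogeneous_op A b \<rho> \<longleftrightarrow>
    (\<forall>a\<in>A. (\<exists>c. \<rho> (tpow a) = scale c (tpow (a + b))) \<and> (a + b \<notin> A \<longrightarrow> \<rho> (tpow a) = 0))"


section \<open>Polynomials in the operators \<open>\<theta>\<^sub>j = t\<^sub>j \<partial>\<^sub>j\<close>\<close>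

definition partial_deriv :: "'n \<Rightarrow> ('n::finite, 'k::field) laurent \<Rightarrow> ('n, 'k) laurent"
  where "partial_deriv j f =
    (\<Sum>a\<in>Poly_Mapping.keys f. Poly_Mapping.single (a - axis j 1) (of_int (a $ j) * Poly_Mapping.lookup f a))"

definition theta :: "'n \<Rightarrow> ('n::finite, 'k::field) laurent \<Rightarrow> ('n, 'k) laurent"
  where "theta j f = tpow (axis j 1) * partial_deriv j f"

text \<open>
  A polynomial in variables indexed by \<open>'n\<close> is a finitely supported map on exponent
  vectors \<^typ>\<open>'n \<Rightarrow>\<^sub>0 nat\<close>.  The product over \<open>j\<close> of the powers of the \<open>\<theta>\<^sub>j\<close> is
  a composition, written as a fold; the order is immaterial because the \<open>\<theta>\<^sub>j\<close> commute.
\<close>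

type_synonym ('n, 'k) mpoly = "('n \<Rightarrow>\<^sub>0 nat) \<Rightarrow>\<^sub>0 'k"

definition theta_power :: "('n \<Rightarrow>\<^sub>0 nat) \<Rightarrow> ('n::finite, 'k::field) laurent \<Rightarrow> ('n, 'k) laurent"
  where "theta_power m =
    Finite_Set.fold (\<lambda>j \<phi>. (theta j ^^ Poly_Mapping.lookup m j) \<circ> \<phi>) id UNIV"

definition theta_op :: "('n, 'k) mpoly \<Rightarrow> ('n::finite, 'k::field) laurent \<Rightarrow> ('n, 'k) laurent"
  where "theta_op q f = (\<Sum>m\<in>Poly_Mapping.keys q. scale (Poly_Mapping.lookup q m) (theta_power m f))"

definition mpoly_eval :: "('n, 'k) mpoly \<Rightarrow> int ^ 'n::finite \<Rightarrow> 'k::field"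
  where "mpoly_eval q a =
    (\<Sum>m\<in>Poly_Mapping.keys q. Poly_Mapping.lookup q m *
      (\<Prod>j\<in>UNIV. of_int (a $ j) ^ Poly_Mapping.lookup m j))"

lemma lookup_scale [simp]: "Poly_Mapping.lookup (scale c f) a = c * Poly_Mapping.lookup f a"
  by (simp add: scale_def map.rep_eq when_def)

lemma lookup_theta: "Poly_Mapping.lookup (theta j f) a = of_int (a $ j) * Poly_Mapping.lookup f a"
proof -
  have "theta j f = (\<Sum>c\<in>Poly_Mapping.keys f.
      Poly_Mapping.single c (of_int (c $ j) * Poly_Mapping.lookup f c))"
    by (simp add: theta_def partial_deriv_def sum_distrib_left mult_single)
  then show ?thesis
    by (simp add: lookup_sum lookup_single when_def in_keys_iff)
qed

lemma lookup_theta_funpow: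
  "Poly_Mapping.lookup ((theta j ^^ n) f) a = of_int (a $ j) ^ n * Poly_Mapping.lookup f a"
  by (induction n) (simp_all add: lookup_theta)

lemma lookup_theta_power:
  fixes f :: "('n::finite, 'k::field) laurent"
  shows "Poly_Mapping.lookup (theta_power m f) a =
    (\<Prod>j\<in>UNIV. of_int (a $ j) ^ Poly_Mapping.lookup m j) * Poly_Mapping.lookup f a"
proof -
  define F where "F = (\<lambda>j (\<phi> :: ('n, 'k) laurent \<Rightarrow> ('n, 'k) laurent).
    (theta j ^^ Poly_Mapping.lookup m j) \<circ> \<phi>)"
  interpret comp_fun_commute F
    by standard (auto intro!: poly_mapping_eqI simp: F_def fun_eq_iff lookup_theta_funpow)
  have "Poly_Mapping.lookup (Finite_Set.fold F id J f) a =
    (\<Prod>j\<in>J. of_int (a $ j) ^ Poly_Mapping.lookup m j) * Poly_Mapping.lookup f a" if "finite J" for J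
    using that
  proof induction
    case (insert x J)
    have step: "Finite_Set.fold F id (insert x J) f =
        (theta x ^^ Poly_Mapping.lookup m x) (Finite_Set.fold F id J f)"
      using insert.hyps by (simp add: fold_insert) (simp add: F_def)
    then show ?case
      by (simp only: step lookup_theta_funpow insert.IH prod.insert[OF insert.hyps] mult.assoc)
  qed simp
  then show ?thesis
    by (simp add: theta_power_def F_def)
qed

lemma theta_op_mono:
  "tpow b * theta_op q (tpow a) = scale (mpoly_eval q a) (tpow (a + b))"
proof -
  have "theta_op q (tpow a) = Poly_Mapping.single a (mpoly_eval q a)"
    by (rule poly_mapping_eqI)
      (simp add: theta_op_def mpoly_eval_def lookup_sum lookup_theta_power lookup_single when_def)
  then have "tpow b * theta_op q (tpow a) = Poly_Mapping.single (a + b) (mpoly_eval q a)"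
    by (simp add: mult_single add.commute)
  also have "\<dots> = scale (mpoly_eval q a) (tpow (a + b))"
    by (rule poly_mapping_eqI) (simp add: lookup_single when_def)
  finally show ?thesis .
qed

end

theory Submission
  imports Defs "HOL-Analysis.Cartesian_Space"
begin

text \<open>
  Write \<open>\<rho>(t\<^sup>a) = c(a) t\<^sup>a\<^sup>+\<^sup>b\<close>.  Commuting with \<open>t\<^sup>s\<close> takes differences of \<open>c\<close> in direction \<open>s\<close>, so an
  operator of order \<open>i\<close> has a \<open>c\<close> that is polynomial of degree at most \<open>i\<close> along every line
  \<open>n \<mapsto> a + n s\<close> in the monoid.  Such a \<open>c\<close> is the restriction of a polynomial \<open>q\<close>, by
  induction on the number of generators of the monoid.  If the new generator \<open>g\<close> is rationally
  independent of the old ones, there is a linear functional that reads off the multiplicity of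
  \<open>g\<close>, and \<open>q\<close> is obtained by Lagrange interpolation in it; otherwise a multiple of \<open>g\<close> is
  a difference of old elements, and the polynomial for the old monoid already works.  The vanishing
  conditions are the hypotheses on \<open>\<rho>\<close> evaluated at the monomials \<open>t\<^sup>a\<close>.
\<close>

section \<open>Submonoids of the lattice\<close>

lemma add_submonoidI:
  "0 \<in> A \<Longrightarrow> (\<And>x y. x \<in> A \<Longrightarrow> y \<in> A \<Longrightarrow> x + y \<in> A) \<Longrightarrow> add_submonoid A"
  by (simp add: add_submonoid_def)

lemma add_submonoid_hull: "add_submonoid (add_submonoid hull G)"
  by (rule hull_in) (auto simp: add_submonoid_def)

lemma add_submonoid_smult:
  fixes a :: "int ^ 'n"
  assumes "add_submonoid A" "a \<in> A"
  shows "int n *s a \<in> A"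
proof (induction n)
  case 0
  then show ?case using assms by (simp add: add_submonoid_def)
next
  case (Suc n)
  have "int (Suc n) *s a = a + int n *s a"
    by (simp add: vec_eq_iff algebra_simps)
  then show ?case using Suc assms by (simp add: add_submonoid_def)
qed

lemma add_submonoid_line:
  fixes a s :: "int ^ 'n"
  assumes "add_submonoid A" "a \<in> A" "s \<in> A"
  shows "a + int n *s s \<in> A"
  using assms add_submonoid_smult[of A s n] by (auto simp: add_submonoid_def)

text \<open>The sums \<open>a' + n g\<close> form a submonoid containing all generators, so
  minimality of the hull applies.\<close>

lemma hull_insert_line:
  fixes g :: "int ^ 'n"
  assumes "a \<in> add_submonoid hull insert g G"
  obtains a' n where "a' \<in> add_submonoid hull G" "a = a' + int n *s g"
proof -
  let ?A = "add_submonoid hull G"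
  let ?T = "{a' + int n *s g | a' n. a' \<in> ?A}"
  have A: "add_submonoid ?A"
    by (rule add_submonoid_hull)
  have 0: "0 \<in> ?A"
    using A by (simp add: add_submonoid_def)
  have "add_submonoid ?T"
  proof (rule add_submonoidI)
    have "0 = (0::int ^ 'n) + int 0 *s g"
      by simp
    then show "0 \<in> ?T"
      using 0 by blast
    fix x y assume "x \<in> ?T" "y \<in> ?T"
    then obtain a c n m where *: "a \<in> ?A" "c \<in> ?A" "x = a + int n *s g" "y = c + int m *s g"
      by blast
    then have "x + y = (a + c) + int (n + m) *s g"
      by (simp add: vec_eq_iff algebra_simps)
    moreover have "a + c \<in> ?A"
      using A * by (simp add: add_submonoid_def)
    ultimately show "x + y \<in> ?T"
      by blast
  qed
  moreover have "insert g G \<subseteq> ?T"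
  proof
    fix x assume "x \<in> insert g G"
    then consider "x = 0 + int 1 *s g" | "x \<in> ?A" "x = x + int 0 *s g"
      using hull_subset[of G add_submonoid] by auto
    then show "x \<in> ?T"
      using 0 by cases blast+
  qed
  ultimately have "add_submonoid hull insert g G \<subseteq> ?T"
    by (rule hull_minimal[rotated])
  with assms that show ?thesis
    by blast
qed

section \<open>Rational dependence on a submonoid of the lattice\<close>

text \<open>Clear denominators in a rational combination, then collect its positive part in
  \<open>u\<close> and its negative part in \<open>v\<close>, since a monoid has no subtraction. The
  equation is coordinatewise because \<open>x\<close> is rational while \<open>u\<close> and
  \<open>v\<close> are integral.\<close>

lemma rat_span_submonoid:
  fixes A :: "(int ^ 'n) set" and x :: "rat ^ 'n"
  assumes A: "add_submonoid A" and x: "x \<in> vec.span ((\<lambda>a. \<chi> j. of_int (a $ j)) ` A)"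
  shows "\<exists>N>0. \<exists>u\<in>A. \<exists>v\<in>A. \<forall>j. of_nat N * x $ j + of_int (v $ j) = of_int (u $ j)"
  using x
proof (induction rule: vec.span_induct_alt)
  case base
  have "0 \<in> A"
    using A by (simp add: add_submonoid_def)
  then show ?case
    by (intro exI[of _ 1] conjI bexI[of _ 0]) auto
next
  case (step c x y)
  then obtain a N u v where a: "a \<in> A" "x = (\<chi> j. of_int (a $ j))"
    and N: "N > 0" "u \<in> A" "v \<in> A" "\<And>j. of_nat N * y $ j + of_int (v $ j) = of_int (u $ j)"
    by blast
  obtain p q where c: "c = of_int p / of_int q" "q > 0"
    by (cases c) (simp add: Fract_of_int_quotient)
  obtain p1 p2 where p: "p = int p1 - int p2"
    by (rule int_diff_cases)
  define r where "r = nat q"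
  have r: "q = int r" "r > 0"
    using c(2) by (auto simp: r_def)
  have mem: "int r *s w + int m *s a \<in> A" if "w \<in> A" for w m
    using that a A by (intro add_submonoid_line add_submonoid_smult)
  \<comment> \<open>With \<open>c = p / r\<close> and \<open>p = p1 - p2\<close>, multiplying
    \<open>c x + y\<close> by \<open>r N\<close> gives \<open>N p a + r (u - v)\<close>; hence the
    new witnesses \<open>r u + p1 N a\<close> and \<open>r v + p2 N a\<close>.\<close>
  show ?case
  proof (rule exI[of _ "r * N"], rule conjI[rotated],
      rule bexI[OF _ mem[OF N(2), of "p1 * N"]], rule bexI[OF _ mem[OF N(3), of "p2 * N"]], rule allI)
    fix j
    have "of_nat (r * N) * (c * x $ j + y $ j) + of_int r * of_int (v $ j)
        + of_nat (p2 * N) * of_int (a $ j) =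
      of_nat N * of_int (a $ j) * (of_nat r * c + of_nat p2)
        + of_nat r * (of_nat N * y $ j + of_int (v $ j))"
      by (simp add: a algebra_simps)
    also have "of_nat r * c + of_nat p2 = of_nat p1"
      using c r p by (simp add: field_simps)
    also note N(4)
    finally show "of_nat (r * N) * (c *s x + y) $ j + of_int ((int r *s v + int (p2 * N) *s a) $ j) =
        of_int ((int r *s u + int (p1 * N) *s a) $ j)"
      by (simp add: algebra_simps)
  qed (use r N in auto)
qed

text \<open>A linear endomorphism that kills a basis of the span of \<open>V\<close> and fixes
  \<open>x\<close> is followed by a coordinate at which \<open>x\<close> is nonzero, normalised to
  be 1 at \<open>x\<close>.\<close>

lemma rational_functional:
  fixes x :: "rat ^ 'n"
  assumes "x \<notin> vec.span V"
  obtains w where "\<And>v. v \<in> V \<Longrightarrow> (\<Sum>j\<in>UNIV. w j * v $ j) = 0" "(\<Sum>j\<in>UNIV. w j * x $ j) = 1"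
proof -
  obtain B where B: "B \<subseteq> V" "vec.independent B" "V \<subseteq> vec.span B"
    by (rule vec.maximal_independent_subset)
  have "x \<notin> vec.span B"
    using assms B vec.span_mono by blast
  then have "vec.independent (insert x B)" "x \<notin> B"
    using B vec.independent_insertI vec.span_base by auto
  then obtain f where f: "Vector_Spaces.linear (*s) (*s) f"
    and fB: "\<And>y. y \<in> insert x B \<Longrightarrow> f y = (if y = x then x else 0)"
    using vec.linear_independent_extend[of "insert x B" "\<lambda>y. if y = x then x else 0"] by blast
  interpret f: Vector_Spaces.linear "(*s)" "(*s)" f
    by (rule f)
  have "x \<noteq> 0"
    using assms vec.span_zero by metis
  then obtain k where k: "x $ k \<noteq> 0"
    by (auto simp: vec_eq_iff)
  have fz: "f v = 0" if "v \<in> V" for v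
  proof -
    have "v \<in> vec.span B"
      using that B by auto
    then show ?thesis
      by (rule vec.linear_eq_0_on_span[OF f, rotated]) (use fB \<open>x \<notin> B\<close> in auto)
  qed
  have f_sum: "f y $ k = (\<Sum>j\<in>UNIV. f (axis j 1) $ k * y $ j)" for y
  proof -
    have "f y = f (\<Sum>j\<in>UNIV. y $ j *s axis j 1)"
      by (simp add: basis_expansion)
    also have "\<dots> = (\<Sum>j\<in>UNIV. y $ j *s f (axis j 1))"
      by (simp add: f.sum f.scale)
    finally show ?thesis
      by (simp add: sum_component mult.commute)
  qed
  define w where "w = (\<lambda>j. f (axis j 1) $ k / x $ k)"
  have w: "(\<Sum>j\<in>UNIV. w j * y $ j) = f y $ k / x $ k" for y
    by (simp add: w_def f_sum[of y] sum_divide_distrib)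
  show ?thesis
    by (rule that[of w]) (use k fz fB in \<open>auto simp: w\<close>)
qed

text \<open>The case split is made over the rationals for two reasons: a rational dependence clears
  to an integral one, and a rational functional maps into any field of characteristic 0 by
  \<open>of_rat\<close>.\<close>

lemma submonoid_functional_or_multiple:
  fixes A :: "(int ^ 'n) set" and g :: "int ^ 'n"
  assumes "add_submonoid A"
  obtains (dependent) N u v where "N > 0" "u \<in> A" "v \<in> A" "int N *s g + v = u"
  | (functional) w :: "'n \<Rightarrow> 'k::field_char_0"
    where "\<And>a. a \<in> A \<Longrightarrow> (\<Sum>j\<in>UNIV. w j * of_int (a $ j)) = 0"
      "(\<Sum>j\<in>UNIV. w j * of_int (g $ j)) = 1"
proof (cases "(\<chi> j. of_int (g $ j)) \<in> vec.span ((\<lambda>a. \<chi> j. (of_int (a $ j) :: rat)) ` A)")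
  case True
  from rat_span_submonoid[OF assms True] obtain N u v
    where N: "N > 0" "u \<in> A" "v \<in> A"
      and eq: "\<And>j. of_nat N * of_int (g $ j) + of_int (v $ j) = (of_int (u $ j) :: rat)"
    by auto
  have "of_int (int N * g $ j + v $ j) = (of_int (u $ j) :: rat)" for j
    using eq[of j] by simp
  then have "int N *s g + v = u"
    unfolding of_int_eq_iff by (simp add: vec_eq_iff)
  with N show ?thesis
    by (rule dependent)
next
  case False
  then obtain w
    where w: "\<And>v. v \<in> (\<lambda>a. \<chi> j. (of_int (a $ j) :: rat)) ` A \<Longrightarrow> (\<Sum>j\<in>UNIV. w j * v $ j) = 0"
      "(\<Sum>j\<in>UNIV. w j * (\<chi> j. of_int (g $ j)) $ j) = 1"
    by (rule rational_functional) blast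
  have of_rat_w: "(\<Sum>j\<in>UNIV. of_rat (w j) * of_int (a $ j)) =
      (of_rat (\<Sum>j\<in>UNIV. w j * (\<chi> j. of_int (a $ j)) $ j) :: 'k)" for a :: "int ^ 'n"
    by (simp add: of_rat_sum of_rat_mult)
  show ?thesis
  proof (rule functional)
    show "(\<Sum>j\<in>UNIV. of_rat (w j) * of_int (a $ j)) = (0::'k)" if "a \<in> A" for a
      unfolding of_rat_w using w(1)[OF imageI[OF that]] by simp
    show "(\<Sum>j\<in>UNIV. of_rat (w j) * of_int (g $ j)) = (1::'k)"
      by (simp only: of_rat_w w) simp
  qed
qed


section \<open>Polynomial functions\<close>

text \<open>Polynomials are handled as functions here, so that substitution and restriction to a
  line become inductions over these rules; \<open>poly_fun_mpoly_eval\<close> returns to formal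
  polynomials.\<close>

inductive poly_fun :: "(('n \<Rightarrow> 'k::comm_ring_1) \<Rightarrow> 'k) \<Rightarrow> bool" where
  const: "poly_fun (\<lambda>x. c)"
| coord: "poly_fun (\<lambda>x. x j)"
| add: "poly_fun F \<Longrightarrow> poly_fun G \<Longrightarrow> poly_fun (\<lambda>x. F x + G x)"
| mult: "poly_fun F \<Longrightarrow> poly_fun G \<Longrightarrow> poly_fun (\<lambda>x. F x * G x)"

lemma poly_fun_sum: "(\<And>j. j \<in> J \<Longrightarrow> poly_fun (F j)) \<Longrightarrow> poly_fun (\<lambda>x. \<Sum>j\<in>J. F j x)"
  by (induction J rule: infinite_finite_induct) (auto intro: poly_fun.intros)

lemma poly_fun_compose:
  assumes "poly_fun F" "\<And>j. poly_fun (G j)"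
  shows "poly_fun (\<lambda>x. F (\<lambda>j. G j x))"
  using assms(1) by induction (auto intro: poly_fun.intros assms(2))

lemma poly_fun_poly: "poly_fun G \<Longrightarrow> poly_fun (\<lambda>x. poly p (G x))"
  by (induction p) (auto intro: poly_fun.intros)

text \<open>The bound \<open>D\<close> depends on \<open>F\<close> alone and serves all lines at
  once: a sum takes the maximum of the two bounds, a product their sum.\<close>

lemma poly_fun_on_line:
  assumes "poly_fun F"
  shows "\<exists>D. \<forall>x y. \<exists>p. degree p \<le> D \<and> (\<forall>t. F (\<lambda>j. x j + t * y j) = poly p t)"
  using assms
proof induction
  case (const c)
  show ?case
    by (intro exI[of _ 0] allI exI[of _ "[:c:]"]) auto
next
  case (coord i)
  show ?case
  proof (intro exI[of _ "1::nat"] allI)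
    fix x y
    show "\<exists>p. degree p \<le> 1 \<and> (\<forall>t. x i + t * y i = poly p t)"
      by (rule exI[of _ "[:x i, y i:]"]) auto
  qed
next
  case (add F G)
  then obtain D E
    where F: "\<And>x y. \<exists>p. degree p \<le> D \<and> (\<forall>t. F (\<lambda>j. x j + t * y j) = poly p t)"
      and G: "\<And>x y. \<exists>p. degree p \<le> E \<and> (\<forall>t. G (\<lambda>j. x j + t * y j) = poly p t)"
    by blast
  show ?case
  proof (intro exI[of _ "max D E"] allI)
    fix x y
    obtain p q where "degree p \<le> D" "\<And>t. F (\<lambda>j. x j + t * y j) = poly p t"
      and "degree q \<le> E" "\<And>t. G (\<lambda>j. x j + t * y j) = poly q t"
      using F G by metis
    then show "\<exists>p. degree p \<le> max D E \<and>
        (\<forall>t. F (\<lambda>j. x j + t * y j) + G (\<lambda>j. x j + t * y j) = poly p t)"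
      by (intro exI[of _ "p + q"]) (auto intro!: degree_add_le)
  qed
next
  case (mult F G)
  then obtain D E
    where F: "\<And>x y. \<exists>p. degree p \<le> D \<and> (\<forall>t. F (\<lambda>j. x j + t * y j) = poly p t)"
      and G: "\<And>x y. \<exists>p. degree p \<le> E \<and> (\<forall>t. G (\<lambda>j. x j + t * y j) = poly p t)"
    by blast
  show ?case
  proof (intro exI[of _ "D + E"] allI)
    fix x y
    obtain p q where "degree p \<le> D" "\<And>t. F (\<lambda>j. x j + t * y j) = poly p t"
      and "degree q \<le> E" "\<And>t. G (\<lambda>j. x j + t * y j) = poly q t"
      using F G by metis
    then show "\<exists>p. degree p \<le> D + E \<and>
        (\<forall>t. F (\<lambda>j. x j + t * y j) * G (\<lambda>j. x j + t * y j) = poly p t)"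
      by (intro exI[of _ "p * q"]) (auto intro: order_trans[OF degree_mult_le])
  qed
qed

section \<open>Evaluation of formal polynomials as a ring homomorphism\<close>

text \<open>Cancellation may shrink the support of a sum; a common index set lets evaluations be
  compared term by term.\<close>

lemma mpoly_eval_superset:
  assumes "finite S" "Poly_Mapping.keys q \<subseteq> S"
  shows "mpoly_eval q a = (\<Sum>m\<in>S. Poly_Mapping.lookup q m *
      (\<Prod>j\<in>UNIV. of_int (a $ j) ^ Poly_Mapping.lookup m j))"
  unfolding mpoly_eval_def using assms
  by (intro sum.mono_neutral_left) (auto simp: in_keys_iff)

lemma mpoly_eval_add: "mpoly_eval (p + q) a = mpoly_eval p a + mpoly_eval q a"
proof -
  let ?S = "Poly_Mapping.keys p \<union> Poly_Mapping.keys q"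
  have "Poly_Mapping.keys (p + q) \<subseteq> ?S"
    by (rule Poly_Mapping.keys_add)
  then show ?thesis
    by (simp add: mpoly_eval_superset[of ?S] lookup_add distrib_right sum.distrib)
qed

lemma mpoly_eval_sum: "mpoly_eval (\<Sum>x\<in>S. f x) a = (\<Sum>x\<in>S. mpoly_eval (f x) a)"
  by (induction S rule: infinite_finite_induct) (auto simp: mpoly_eval_add, simp_all add: mpoly_eval_def)

lemma mpoly_eval_single:
  "mpoly_eval (Poly_Mapping.single m c) a =
    c * (\<Prod>j\<in>UNIV. of_int (a $ j) ^ Poly_Mapping.lookup m j)"
  by (simp add: mpoly_eval_superset[of "{m}"] keys_single)

lemma mpoly_eval_mult: "mpoly_eval (p * q) a = mpoly_eval p a * mpoly_eval q a"
proof -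
  let ?p = "\<lambda>m. Poly_Mapping.single m (Poly_Mapping.lookup p m)"
  let ?q = "\<lambda>m. Poly_Mapping.single m (Poly_Mapping.lookup q m)"
  have "p * q = (\<Sum>m\<in>Poly_Mapping.keys p. ?p m) * (\<Sum>m\<in>Poly_Mapping.keys q. ?q m)"
    by (simp flip: laurent_expand)
  also have "mpoly_eval \<dots> a =
      (\<Sum>m\<in>Poly_Mapping.keys p. \<Sum>n\<in>Poly_Mapping.keys q. mpoly_eval (?p m) a * mpoly_eval (?q n) a)"
    by (simp add: sum_product mpoly_eval_sum mult_single mpoly_eval_single lookup_add power_add
        prod.distrib ac_simps)
  also have "\<dots> = mpoly_eval (\<Sum>m\<in>Poly_Mapping.keys p. ?p m) a * mpoly_eval (\<Sum>m\<in>Poly_Mapping.keys q. ?q m) a"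
    by (simp add: sum_product mpoly_eval_sum)
  finally show ?thesis
    by (simp flip: laurent_expand)
qed

lemma poly_fun_mpoly_eval:
  fixes F :: "('n::finite \<Rightarrow> 'k::field) \<Rightarrow> 'k"
  assumes "poly_fun F"
  shows "\<exists>q. \<forall>a. mpoly_eval q a = F (\<lambda>j. of_int (a $ j))"
  using assms
proof induction
  case (const c)
  show ?case
    by (rule exI[of _ "Poly_Mapping.single 0 c"]) (simp add: mpoly_eval_single)
next
  case (coord i)
  show ?case
  proof (intro exI[of _ "Poly_Mapping.single (Poly_Mapping.single i 1) 1"] allI)
    fix a :: "int ^ 'n"
    have "(\<Prod>j\<in>UNIV. (of_int (a $ j) :: 'k) ^ Poly_Mapping.lookup (Poly_Mapping.single i 1) j) =
        (\<Prod>j\<in>UNIV. if j = i then of_int (a $ i) else 1)"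
      by (intro prod.cong) (auto simp: lookup_single when_def)
    then show "mpoly_eval (Poly_Mapping.single (Poly_Mapping.single i 1) 1) a = (of_int (a $ i) :: 'k)"
      by (simp add: mpoly_eval_single)
  qed
next
  case (add F G)
  then show ?case by (metis mpoly_eval_add)
next
  case (mult F G)
  then show ?case by (metis mpoly_eval_mult)
qed


section \<open>Functions that are polynomial on lines\<close>

text \<open>Base point and direction both lie in \<open>A\<close>, so the line stays in the monoid
  for natural \<open>n\<close>. The bound \<open>D\<close> is uniform, so the same
  \<open>D + 1\<close> interpolation nodes serve every line.\<close>

definition poly_on_lines ::
  "(int ^ 'n) set \<Rightarrow> nat \<Rightarrow> (int ^ 'n \<Rightarrow> 'k::comm_ring_1) \<Rightarrow> bool"
  where "poly_on_lines A D c \<longleftrightarrow>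
    (\<forall>a\<in>A. \<forall>s\<in>A. \<exists>p. degree p \<le> D \<and> (\<forall>n. c (a + int n *s s) = poly p (of_nat n)))"

lemma poly_on_linesE:
  assumes "poly_on_lines A D c" "a \<in> A" "s \<in> A"
  obtains p where "degree p \<le> D" "\<And>n. c (a + int n *s s) = poly p (of_nat n)"
  using assms unfolding poly_on_lines_def by blast

section \<open>Interpolation in one variable at natural numbers\<close>

lemma poly_eq_0_if_many_nat_roots:
  fixes p :: "'k::field_char_0 poly"
  assumes "degree p \<le> D" "finite K" "D < card K" "\<And>k. k \<in> K \<Longrightarrow> poly p (of_nat k) = 0"
  shows "p = 0"
proof (rule poly_eqI_degree[of "of_nat ` K"])
  have "card (of_nat ` K :: 'k set) = card K"
    by (intro card_image) (simp add: inj_on_def)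
  then show "degree p < card (of_nat ` K :: 'k set)" "degree 0 < card (of_nat ` K :: 'k set)"
    using assms by auto
qed (use assms in auto)

text \<open>These are the Lagrange polynomials for the nodes \<open>0, ..., D\<close>. They do not
  depend on \<open>p\<close>, which allows \<open>p\<close> to vary with a parameter later.\<close>

lemma interpolation_basis:
  "\<exists>L :: nat \<Rightarrow> 'k::field_char_0 poly. \<forall>p. degree p \<le> D \<longrightarrow>
    (\<forall>x. poly p x = (\<Sum>j\<le>D. poly p (of_nat j) * poly (L j) x))"
proof -
  define L :: "nat \<Rightarrow> 'k poly" where
    "L = (\<lambda>j. \<Prod>k\<in>{..D} - {j}. Polynomial.smult (1 / (of_nat j - of_nat k)) [:- of_nat k, 1:])"
  have deg: "degree (L j) \<le> D" if "j \<le> D" for j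
  proof -
    have "degree (L j) \<le> (\<Sum>k\<in>{..D} - {j}. 1)"
      unfolding L_def by (rule order_trans[OF degree_prod_sum_le sum_mono]) auto
    also have "\<dots> = D"
      using that by (simp add: card_Diff_singleton)
    finally show ?thesis .
  qed
  have eval: "poly (L j) (of_nat i) = (if i = j then 1 else 0)" if "i \<le> D" for i j
    using that by (auto simp: L_def poly_prod divide_self_if diff_divide_distrib[symmetric] intro!: prod.neutral)
  have "poly p x = (\<Sum>j\<le>D. poly p (of_nat j) * poly (L j) x)" if "degree p \<le> D" for p x
  proof -
    \<comment> \<open>The interpolation error has degree at most \<open>D\<close> and vanishes at
      \<open>D + 1\<close> nodes.\<close>
    define q where "q = p - (\<Sum>j\<le>D. Polynomial.smult (poly p (of_nat j)) (L j))"
    have "degree q \<le> D"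
      unfolding q_def using that deg
      by (intro degree_diff_le degree_sum_le order_trans[OF degree_smult_le]) auto
    moreover have "poly q (of_nat i) = 0" if "i \<in> {..D}" for i
      using that by (simp add: q_def poly_sum eval if_distrib[of "(*) _"] cong: if_cong)
    ultimately have "q = 0"
      by (intro poly_eq_0_if_many_nat_roots[of q D "{..D}"]) auto
    then have "p = (\<Sum>j\<le>D. Polynomial.smult (poly p (of_nat j)) (L j))"
      by (simp add: q_def)
    then have "poly p x = poly (\<Sum>j\<le>D. Polynomial.smult (poly p (of_nat j)) (L j)) x"
      by simp
    then show ?thesis
      by (simp add: poly_sum)
  qed
  then show ?thesis
    by blast
qed

lemma poly_on_lines_diff_poly_fun:
  assumes "poly_on_lines A D c" "poly_fun F"
  shows "\<exists>E. poly_on_lines A E (\<lambda>a. c a - F (\<lambda>j. of_int (a $ j)))"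
proof -
  obtain E where E: "\<And>x y. \<exists>p. degree p \<le> E \<and> (\<forall>t. F (\<lambda>j. x j + t * y j) = poly p t)"
    using poly_fun_on_line[OF assms(2)] by blast
  have "\<exists>p. degree p \<le> max D E \<and>
      (\<forall>n. c (a + int n *s s) - F (\<lambda>j. of_int ((a + int n *s s) $ j)) = poly p (of_nat n))"
    if as: "a \<in> A" "s \<in> A" for a s
  proof -
    obtain p where p: "degree p \<le> D" "\<And>n. c (a + int n *s s) = poly p (of_nat n)"
      using poly_on_linesE[OF assms(1) as] by blast
    obtain q where q: "degree q \<le> E"
      "\<And>t. F (\<lambda>j. of_int (a $ j) + t * of_int (s $ j)) = poly q t"
      using E by metis
    show ?thesis
      using p q by (intro exI[of _ "p - q"]) (auto intro!: degree_diff_le)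
  qed
  then show ?thesis
    unfolding poly_on_lines_def by blast
qed

text \<open>
  If \<open>N g + v = u\<close> with \<open>u, v \<in> A\<close>, then \<open>h (a + l v + n g)\<close> has, for fixed \<open>l \<ge> D\<close>, the
  roots \<open>n = N k\<close> with \<open>k \<le> D\<close>, so it vanishes for all \<open>l \<ge> D\<close>, hence also for \<open>l = 0\<close>.
\<close>

lemma poly_on_lines_zero_extend:
  fixes h :: "int ^ 'n \<Rightarrow> 'k::field_char_0"
  assumes B: "add_submonoid B" and h: "poly_on_lines B D h"
    and A: "add_submonoid A" "A \<subseteq> B" and g: "g \<in> B"
    and N: "N > 0" "u \<in> A" "v \<in> A" "int N *s g + v = u"
    and zero: "\<And>a. a \<in> A \<Longrightarrow> h a = 0" and a: "a \<in> A"
  shows "h (a + int n *s g) = 0"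
proof -
  have large: "h ((a + int n *s g) + int l *s v) = 0" if l: "D \<le> l" for l
  proof -
    have "a + int l *s v \<in> B" "g \<in> B"
      using add_submonoid_line[OF A(1) a N(3)] A g by auto
    then obtain p where p: "degree p \<le> D"
      "\<And>n. h (a + int l *s v + int n *s g) = poly p (of_nat n)"
      by (rule poly_on_linesE[OF h]) blast
    have "p = 0"
    proof (rule poly_eq_0_if_many_nat_roots[of p D "(*) N ` {..D}"])
      have "card ((*) N ` {..D}) = card {..D}"
        using N by (intro card_image) (auto simp: inj_on_def)
      then show "D < card ((*) N ` {..D})"
        by simp
      fix m assume "m \<in> (*) N ` {..D}"
      then obtain k where k: "m = N * k" "k \<le> D"
        by auto
      \<comment> \<open>Since \<open>N g + v = u\<close>, each of the \<open>k\<close> steps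
        \<open>N g\<close> trades one \<open>v\<close> for one \<open>u\<close>;
        \<open>k \<le> D \<le> l\<close> guarantees that enough copies of \<open>v\<close> are
        present.\<close>
      have "a + int l *s v + int m *s g = a + int (l - k) *s v + int k *s u"
        using k l by (simp add: N(4)[symmetric] vec_eq_iff of_nat_diff algebra_simps)
      also have "\<dots> \<in> A"
        using A a N by (intro add_submonoid_line) auto
      finally show "poly p (of_nat m) = 0"
        using zero p by metis
    qed (use p in auto)
    then have "h (a + int l *s v + int n *s g) = 0"
      using p by simp
    then show ?thesis
      by (simp add: ac_simps)
  qed
  have "a + int n *s g \<in> B" "v \<in> B"
    using add_submonoid_line[OF B _ g] a N A by auto
  then obtain p where p: "degree p \<le> D"
    "\<And>l. h (a + int n *s g + int l *s v) = poly p (of_nat l)"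
    by (rule poly_on_linesE[OF h]) blast
  \<comment> \<open>Along direction \<open>v\<close> all \<open>l \<ge> D\<close> are roots; the
    \<open>D + 1\<close> values from \<open>D\<close> to \<open>2 D\<close> already suffice.\<close>
  have "p = 0"
    by (rule poly_eq_0_if_many_nat_roots[of p D "{D..D + D}"]) (use p large in auto)
  then show ?thesis
    using p(2)[of 0] by simp
qed

text \<open>The induction keeps \<open>c\<close> arbitrary, because the hypothesis is applied to the
  translates of \<open>c\<close> by multiples of the new generator.\<close>

lemma poly_on_lines_poly_fun:
  fixes c :: "int ^ 'n \<Rightarrow> 'k::field_char_0"
  assumes "finite G" "poly_on_lines (add_submonoid hull G) D c"
  shows "\<exists>F. poly_fun F \<and> (\<forall>a\<in>add_submonoid hull G. c a = F (\<lambda>j. of_int (a $ j)))"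
  using assms
proof (induction G arbitrary: c rule: finite_induct)
  case empty
  have "add_submonoid hull {} \<subseteq> {0 :: int ^ 'n}"
    by (rule hull_minimal) (auto simp: add_submonoid_def)
  then show ?case
    by (intro exI[of _ "\<lambda>x. c 0"]) (auto intro: poly_fun.intros)
next
  case (insert g G)
  let ?A = "add_submonoid hull G" and ?B = "add_submonoid hull insert g G"
  have A: "add_submonoid ?A" and B: "add_submonoid ?B"
    by (rule add_submonoid_hull)+
  have AB: "?A \<subseteq> ?B" and g: "g \<in> ?B"
    by (auto intro!: hull_mono hull_inc)
  have shift: "poly_on_lines ?A D (\<lambda>a. c (a + int k *s g))" for k
    unfolding poly_on_lines_def
  proof (intro ballI)
    fix a s assume as: "a \<in> ?A" "s \<in> ?A"
    then have "a + int k *s g \<in> ?B" "s \<in> ?B"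
      using AB g by (auto intro!: add_submonoid_line[OF B])
    from poly_on_linesE[OF insert.prems this]
    show "\<exists>p. degree p \<le> D \<and> (\<forall>n. c (a + int n *s s + int k *s g) = poly p (of_nat n))"
      by (metis add.assoc add.commute)
  qed
  from A show ?case
  proof (cases rule: submonoid_functional_or_multiple[where g = g and 'k = 'k])
    case (dependent N u v)
    obtain F where F: "poly_fun F" "\<And>a. a \<in> ?A \<Longrightarrow> c a = F (\<lambda>j. of_int (a $ j))"
      using insert.IH[of c] shift[of 0] by auto
    \<comment> \<open>The polynomial fitted on the old monoid is tested on the new one: the error is
      polynomial on lines and vanishes on \<open>?A\<close>, hence everywhere on
      \<open>?B\<close>.\<close>
    define h where "h = (\<lambda>a. c a - F (\<lambda>j. of_int (a $ j)))"
    obtain E where E: "poly_on_lines ?B E h"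
      using poly_on_lines_diff_poly_fun[OF insert.prems F(1)] unfolding h_def by blast
    have "h a = 0" if a: "a \<in> ?B" for a
    proof -
      obtain a' n where "a' \<in> ?A" "a = a' + int n *s g"
        using a by (rule hull_insert_line)
      then show ?thesis
        using poly_on_lines_zero_extend[OF B E A AB g dependent] F(2) by (simp add: h_def)
    qed
    then show ?thesis
      using F(1) by (auto simp: h_def)
  next
    case (functional w)
    \<comment> \<open>On \<open>a' + n g\<close> with \<open>a'\<close> in \<open>?A\<close> this
      functional takes the value \<open>n\<close>.\<close>
    define l where "l = (\<lambda>x :: 'n \<Rightarrow> 'k. \<Sum>j\<in>UNIV. w j * x j)"
    obtain F where F: "\<And>k. poly_fun (F k)"
      "\<And>k a. a \<in> ?A \<Longrightarrow> c (a + int k *s g) = F k (\<lambda>j. of_int (a $ j))"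
      using insert.IH[OF shift] by metis
    obtain L :: "nat \<Rightarrow> 'k poly" where L: "\<And>p x. degree p \<le> D \<Longrightarrow>
        poly p x = (\<Sum>k\<le>D. poly p (of_nat k) * poly (L k) x)"
      using interpolation_basis by metis
    \<comment> \<open>The vector \<open>x - l(x) g\<close> recovers \<open>a'\<close> from
      \<open>a' + n g\<close>. There \<open>F k\<close> gives the value on the slice
      \<open>n = k\<close>, and the slices \<open>k \<le> D\<close> are interpolated in
      \<open>l(x)\<close>.\<close>
    define H where "H = (\<lambda>x :: 'n \<Rightarrow> 'k.
      \<Sum>k\<le>D. F k (\<lambda>j. x j + (- of_int (g $ j)) * l x) * poly (L k) (l x))"
    have l: "poly_fun l"
      unfolding l_def by (intro poly_fun_sum poly_fun.intros)
    have "poly_fun (\<lambda>x. x j + (- of_int (g $ j)) * l x)" for j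
      by (rule poly_fun.add[OF poly_fun.coord poly_fun.mult[OF poly_fun.const l]])
    then have "poly_fun H"
      unfolding H_def by (intro poly_fun_sum poly_fun.mult poly_fun_compose[OF F(1)] poly_fun_poly l)
    moreover have "c a = H (\<lambda>j. of_int (a $ j))" if a: "a \<in> ?B" for a
    proof -
      obtain a' n where a': "a' \<in> ?A" "a = a' + int n *s g"
        using a by (rule hull_insert_line)
      have l: "l (\<lambda>j. of_int (a $ j)) = of_nat n"
      proof -
        have "l (\<lambda>j. of_int (a $ j)) = (\<Sum>j\<in>UNIV. w j * of_int (a' $ j)) +
            of_nat n * (\<Sum>j\<in>UNIV. w j * of_int (g $ j))"
          by (simp add: l_def a' sum_distrib_left algebra_simps sum.distrib)
        then show ?thesis
          using functional a' by simp
      qed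
      have "a' \<in> ?B"
        using a' AB by auto
      then obtain p where p: "degree p \<le> D" "\<And>n. c (a' + int n *s g) = poly p (of_nat n)"
        by (rule poly_on_linesE[OF insert.prems _ g]) blast
      have "c a = (\<Sum>k\<le>D. poly p (of_nat k) * poly (L k) (of_nat n))"
        using a' p L by simp
      also have "\<dots> = (\<Sum>k\<le>D. F k (\<lambda>j. of_int (a' $ j)) * poly (L k) (of_nat n))"
        using F(2)[OF a'(1)] by (simp flip: p(2))
      also have "\<dots> = H (\<lambda>j. of_int (a $ j))"
        by (simp add: H_def l) (simp add: a')
      finally show ?thesis .
    qed
    ultimately show ?thesis
      by blast
  qed
qed


section \<open>Differential operators on semigroup rings\<close>

lemma lookup_tpow_mult:
  fixes f :: "('n::finite, 'k::field) laurent"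
  shows "Poly_Mapping.lookup (tpow s * f) (s + x) = Poly_Mapping.lookup f x"
proof -
  have "tpow s * f = (\<Sum>a\<in>Poly_Mapping.keys f. Poly_Mapping.single (s + a) (Poly_Mapping.lookup f a))"
    by (subst (1) laurent_expand[of f]) (simp add: sum_distrib_left mult_single)
  then show ?thesis
    by (simp add: lookup_sum lookup_single when_def in_keys_iff)
qed

lemma lookup_theta_op:
  "Poly_Mapping.lookup (theta_op q f) a = mpoly_eval q a * Poly_Mapping.lookup f a"
  by (simp add: theta_op_def mpoly_eval_def lookup_sum lookup_theta_power sum_distrib_right mult.assoc)

text \<open>A scalar acts as multiplication by a constant of the ring, available because
  \<open>0\<close> lies in \<open>A\<close>. This supplies the scalar linearity that order 0 does
  not state explicitly.\<close>

lemma Hom_self_subset_Hom_scalar: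
  assumes A: "add_submonoid A"
  shows "Hom_self (semigroup_algebra A) \<subseteq> Hom_scalar (semigroup_algebra A :: ('k::field, ('n::finite, 'k) laurent) module)"
proof -
  have "scale c f = Poly_Mapping.single 0 c * f" for c and f :: "('n, 'k) laurent"
  proof (rule poly_mapping_eqI)
    fix a
    have "Poly_Mapping.single 0 c * f = (\<Sum>a\<in>Poly_Mapping.keys f. Poly_Mapping.single a (c * Poly_Mapping.lookup f a))"
      by (subst (1) laurent_expand[of f]) (simp add: sum_distrib_left mult_single)
    then show "Poly_Mapping.lookup (scale c f) a = Poly_Mapping.lookup (Poly_Mapping.single 0 c * f) a"
      by (simp add: lookup_sum lookup_single when_def in_keys_iff)
  qed
  then show ?thesis
    using A unfolding Hom_self_def Hom_scalar_def semigroup_algebra_def add_submonoid_def by auto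
qed

lemma diff_ops_subset_Hom_scalar:
  assumes "add_submonoid A"
  shows "diff_ops (semigroup_algebra A) i \<subseteq> Hom_scalar (semigroup_algebra A :: ('k::field, ('n::finite, 'k) laurent) module)"
  using Hom_self_subset_Hom_scalar[OF assms] by (cases i) auto

lemma Hom_scalar_expand:
  fixes \<delta> :: "('n::finite, 'k::field) laurent \<Rightarrow> ('n, 'k) laurent"
  assumes \<delta>: "\<delta> \<in> Hom_scalar (semigroup_algebra A)" and f: "Poly_Mapping.keys f \<subseteq> A"
  shows "\<delta> f = (\<Sum>a\<in>Poly_Mapping.keys f. scale (Poly_Mapping.lookup f a) (\<delta> (tpow a)))"
proof -
  have add: "\<delta> (x + y) = \<delta> x + \<delta> y" if "Poly_Mapping.keys x \<subseteq> A" "Poly_Mapping.keys y \<subseteq> A" for x y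
    using \<delta> that by (auto simp: Hom_scalar_def additive_on_def semigroup_algebra_def)
  have \<delta>_scale: "\<delta> (scale r x) = scale r (\<delta> x)" if "Poly_Mapping.keys x \<subseteq> A" for r x
    using \<delta> that by (auto simp: Hom_scalar_def semigroup_algebra_def)
  have zero: "\<delta> 0 = 0"
    using add[of 0 0] by simp
  have single: "\<delta> (Poly_Mapping.single a r) = scale r (\<delta> (tpow a))" if "a \<in> A" for a r
  proof -
    have "Poly_Mapping.single a r = scale r (tpow a)"
      by (rule poly_mapping_eqI) (simp add: lookup_single when_def)
    then show ?thesis
      using that by (simp add: \<delta>_scale)
  qed
  have "\<delta> (\<Sum>a\<in>S. Poly_Mapping.single a (Poly_Mapping.lookup f a)) =
      (\<Sum>a\<in>S. scale (Poly_Mapping.lookup f a) (\<delta> (tpow a)))" if "S \<subseteq> A" "finite S" for S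
    using that(2,1)
  proof (induction S rule: finite_induct)
    case (insert x S)
    have "Poly_Mapping.keys (\<Sum>a\<in>S. Poly_Mapping.single a (Poly_Mapping.lookup f a)) \<subseteq> A"
      using insert.prems by (intro order_trans[OF keys_sum]) (auto split: if_splits)
    moreover have "Poly_Mapping.keys (Poly_Mapping.single x (Poly_Mapping.lookup f x)) \<subseteq> A"
      using insert.prems by auto
    ultimately have "\<delta> (\<Sum>a\<in>insert x S. Poly_Mapping.single a (Poly_Mapping.lookup f a)) =
        \<delta> (Poly_Mapping.single x (Poly_Mapping.lookup f x)) +
        \<delta> (\<Sum>a\<in>S. Poly_Mapping.single a (Poly_Mapping.lookup f a))"
      unfolding sum.insert[OF insert.hyps] by (intro add)
    also have "\<delta> (Poly_Mapping.single x (Poly_Mapping.lookup f x)) =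
        scale (Poly_Mapping.lookup f x) (\<delta> (tpow x))"
      using insert.prems by (intro single) simp
    also have "\<delta> (\<Sum>a\<in>S. Poly_Mapping.single a (Poly_Mapping.lookup f a)) =
        (\<Sum>a\<in>S. scale (Poly_Mapping.lookup f a) (\<delta> (tpow a)))"
      using insert.prems by (intro insert.IH) simp
    finally show ?case
      by (simp only: sum.insert[OF insert.hyps])
  qed (simp add: zero)
  from this[OF f] show ?thesis
    by (simp flip: laurent_expand)
qed

text \<open>
  The commutator with \<open>t\<^sup>s\<close> takes the difference in direction \<open>s\<close> of the coefficient function
  \<open>a \<mapsto> \<langle>t\<^sup>a\<^sup>+\<^sup>b\<rangle> \<delta>(t\<^sup>a)\<close>; \<open>\<delta>\<close> itself need not be homogeneous.
\<close>

lemma diff_ops_coefficient_binomial: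
  fixes \<delta> :: "('n::finite, 'k::field) laurent \<Rightarrow> ('n, 'k) laurent"
  assumes A: "add_submonoid A" and \<delta>: "\<delta> \<in> diff_ops (semigroup_algebra A) i"
    and as: "a \<in> A" "s \<in> A"
  shows "\<exists>e. \<forall>n. Poly_Mapping.lookup (\<delta> (tpow (a + int n *s s))) (a + int n *s s + b) =
    (\<Sum>j\<le>i. e j * of_nat (n choose j))"
  using \<delta>
proof (induction i arbitrary: \<delta> b)
  case 0
  \<comment> \<open>An operator of order 0 commutes with every power of \<open>t^s\<close>, so its
    coefficient is constant along the line.\<close>
  have "Poly_Mapping.lookup (\<delta> (tpow (a + int n *s s))) (a + int n *s s + b) =
      Poly_Mapping.lookup (\<delta> (tpow a)) (a + b)" for n
  proof -
    have "int n *s s \<in> A"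
      using A as by (intro add_submonoid_smult)
    then have "\<delta> (tpow (int n *s s) * tpow a) = tpow (int n *s s) * \<delta> (tpow a)"
      using 0 as by (simp add: Hom_self_def semigroup_algebra_def)
    then have "\<delta> (tpow (a + int n *s s)) = tpow (int n *s s) * \<delta> (tpow a)"
      by (simp add: mult_single add.commute)
    then show ?thesis
      using lookup_tpow_mult[of "int n *s s" "\<delta> (tpow a)" "a + b"] by (simp add: ac_simps)
  qed
  then show ?case
    by (intro exI[of _ "\<lambda>j. Poly_Mapping.lookup (\<delta> (tpow a)) (a + b)"]) simp
next
  case (Suc i)
  let ?S = "semigroup_algebra A :: ('k, ('n, 'k) laurent) module"
  define \<phi> where "\<phi> = (\<lambda>n. Poly_Mapping.lookup (\<delta> (tpow (a + int n *s s))) (a + int n *s s + b))"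
  have s: "tpow s \<in> carrier ?S"
    using as by (simp add: semigroup_algebra_def)
  then have "commutator ?S \<delta> (tpow s) \<in> diff_ops ?S i"
    using Suc.prems by simp
  \<comment> \<open>Multiplication by \<open>t^s\<close> raises degrees by \<open>s\<close>, so the
    commutator is examined in degree \<open>b + s\<close>.\<close>
  from Suc.IH[OF this, of "b + s"] obtain e where e: "\<And>n.
      Poly_Mapping.lookup (commutator ?S \<delta> (tpow s) (tpow (a + int n *s s))) (a + int n *s s + (b + s)) =
      (\<Sum>j\<le>i. e j * of_nat (n choose j))"
    by blast
  have \<delta>_closed: "\<delta> f \<in> carrier ?S" if "f \<in> carrier ?S" for f
    using Suc.prems that by (auto simp: Hom_scalar_def additive_on_def)
  have mult_closed: "f * g \<in> carrier ?S" if "f \<in> carrier ?S" "g \<in> carrier ?S" for f g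
    using that cring_semigroup_algebra[OF A, where 'k = 'k]
      monoid.m_closed[of ?S f g] cring.axioms(1) ring.is_monoid
    by (fastforce simp: semigroup_algebra_def)
  have diff: "\<phi> (Suc n) - \<phi> n = (\<Sum>j\<le>i. e j * of_nat (n choose j))" for n
  proof -
    let ?x = "a + int n *s s"
    have x: "tpow ?x \<in> carrier ?S"
      using add_submonoid_line[OF A as] by (simp add: semigroup_algebra_def)
    have "commutator ?S \<delta> (tpow s) (tpow ?x) = \<delta> (tpow s * tpow ?x) - tpow s * \<delta> (tpow ?x)"
      using semigroup_algebra_minus[OF A \<delta>_closed[OF mult_closed[OF s x]] mult_closed[OF s \<delta>_closed[OF x]]]
      by (simp only: commutator_def) (simp add: semigroup_algebra_def)
    also have "tpow s * tpow ?x = (tpow (a + int (Suc n) *s s) :: ('n, 'k) laurent)"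
      by (simp add: mult_single vec_eq_iff algebra_simps)
    finally have "(\<Sum>j\<le>i. e j * of_nat (n choose j)) =
        Poly_Mapping.lookup (\<delta> (tpow (a + int (Suc n) *s s))) (?x + (b + s)) -
        Poly_Mapping.lookup (tpow s * \<delta> (tpow ?x)) (?x + (b + s))"
      using e[of n] by (simp add: lookup_minus)
    also have "?x + (b + s) = a + int (Suc n) *s s + b"
      by (simp add: vec_eq_iff algebra_simps)
    also have "Poly_Mapping.lookup (tpow s * \<delta> (tpow ?x)) (a + int (Suc n) *s s + b) =
        Poly_Mapping.lookup (tpow s * \<delta> (tpow ?x)) (s + (?x + b))"
      by (rule arg_cong[where f = "Poly_Mapping.lookup _"]) (simp add: vec_eq_iff algebra_simps)
    also have "\<dots> = \<phi> n"
      by (simp only: lookup_tpow_mult \<phi>_def)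
    finally show ?thesis
      by (simp add: \<phi>_def)
  qed
  \<comment> \<open>This is Newton's forward difference formula: summing the differences shifts each
    \<open>e j\<close> to position \<open>j + 1\<close>, by Pascal's rule, and puts
    \<open>\<phi> 0\<close> in front.\<close>
  have "\<phi> n = (\<Sum>j\<le>Suc i. (case j of 0 \<Rightarrow> \<phi> 0 | Suc j \<Rightarrow> e j) * of_nat (n choose j))" for n
  proof (induction n)
    case 0
    show ?case
      by (simp add: sum.atMost_Suc_shift del: sum.atMost_Suc)
  next
    case (Suc n)
    have "\<phi> (Suc n) = \<phi> n + (\<Sum>j\<le>i. e j * of_nat (n choose j))"
      using diff[of n] by (simp add: algebra_simps)
    then show ?case
      using Suc by (simp add: sum.atMost_Suc_shift algebra_simps sum.distrib del: sum.atMost_Suc)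
  qed
  then show ?case
    unfolding \<phi>_def by blast
qed

text \<open>The binomial coefficient is a falling factorial divided by \<open>fact j\<close>, a
  division that uses characteristic 0.\<close>

lemma binomial_poly:
  "\<exists>p :: 'k::field_char_0 poly. degree p \<le> j \<and> (\<forall>n. poly p (of_nat n) = of_nat (n choose j))"
proof (intro exI[of _ "Polynomial.smult (1 / fact j) (\<Prod>k<j. [:- of_nat k, 1:])"] conjI allI)
  have "degree (\<Prod>k<j. [:- of_nat k, 1 :: 'k:]) \<le> (\<Sum>k<j. 1)"
    by (rule order_trans[OF degree_prod_sum_le sum_mono]) auto
  then show "degree (Polynomial.smult (1 / fact j) (\<Prod>k<j. [:- of_nat k, 1 :: 'k:])) \<le> j"
    using degree_smult_le order_trans by fastforce
  show "poly (Polynomial.smult (1 / fact j) (\<Prod>k<j. [:- of_nat k, 1:])) (of_nat n) = (of_nat (n choose j) :: 'k)" for n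
    by (simp add: binomial_gbinomial gbinomial_prod_rev poly_prod atLeast0LessThan)
qed

lemma diff_ops_poly_on_lines:
  fixes \<delta> :: "('n::finite, 'k::field_char_0) laurent \<Rightarrow> ('n, 'k) laurent"
  assumes "add_submonoid A" "\<delta> \<in> diff_ops (semigroup_algebra A) i"
  shows "poly_on_lines A i (\<lambda>a. Poly_Mapping.lookup (\<delta> (tpow a)) (a + b))"
  unfolding poly_on_lines_def
proof (intro ballI)
  fix a s assume as: "a \<in> A" "s \<in> A"
  obtain e where e: "\<And>n. Poly_Mapping.lookup (\<delta> (tpow (a + int n *s s))) (a + int n *s s + b) =
      (\<Sum>j\<le>i. e j * of_nat (n choose j))"
    using diff_ops_coefficient_binomial[OF assms as] by blast
  obtain P :: "nat \<Rightarrow> 'k poly"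
    where P: "\<And>j. degree (P j) \<le> j" "\<And>j n. poly (P j) (of_nat n) = of_nat (n choose j)"
    using binomial_poly by metis
  have "degree (\<Sum>j\<le>i. Polynomial.smult (e j) (P j)) \<le> i"
    using P(1) by (intro degree_sum_le order_trans[OF degree_smult_le]) (auto intro: order_trans)
  then show "\<exists>p. degree p \<le> i \<and> (\<forall>n. Poly_Mapping.lookup (\<delta> (tpow (a + int n *s s)))
      (a + int n *s s + b) = poly p (of_nat n))"
    by (intro exI[of _ "\<Sum>j\<le>i. Polynomial.smult (e j) (P j)"]) (simp add: e P poly_sum)
qed

section \<open>Projections of monomials and the vanishing conditions\<close>

lemma keep_single: "keep B (Poly_Mapping.single a r) = (if a \<in> B then Poly_Mapping.single a r else 0)"
  by (auto simp: keep_def)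

lemma monoidal_complexD:
  assumes "monoidal_complex \<Sigma> M" "\<tau> \<in> \<Sigma>"
  shows "fin_gen_monoid (M \<tau>)" and "a \<in> M \<tau> \<Longrightarrow> rvec a \<in> \<tau>"
    and "\<upsilon> \<in> \<Sigma> \<Longrightarrow> \<upsilon> \<subseteq> \<tau> \<Longrightarrow> M \<upsilon> = {a \<in> M \<tau>. rvec a \<in> \<upsilon>}"
proof -
  note complex = assms(1)[unfolded monoidal_complex_def]
  note cone = bspec[OF conjunct1[OF complex] assms(2)]
  show "fin_gen_monoid (M \<tau>)"
    by (rule conjunct1[OF cone])
  show "rvec a \<in> \<tau>" if "a \<in> M \<tau>"
    using conjunct1[OF conjunct2[OF cone]] that by (rule subsetD[OF _ imageI])
  show "M \<upsilon> = {a \<in> M \<tau>. rvec a \<in> \<upsilon>}" if "\<upsilon> \<in> \<Sigma>" "\<upsilon> \<subseteq> \<tau>"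
    by (rule mp[OF bspec[OF bspec[OF conjunct2[OF complex] that(1)] assms(2)] that(2)])
qed

theorem proposition3p3:
  fixes \<Sigma> :: "(real ^ 'n) set set"
    and M :: "(real ^ 'n) set \<Rightarrow> (int ^ 'n) set"
    and \<sigma> :: "(real ^ 'n) set"
    and i :: nat
    and b :: "int ^ 'n"
    and \<rho> :: "('n, 'k::{alg_closed_field, field_char_0}) laurent \<Rightarrow> ('n, 'k) laurent"
  assumes "rational_pointed_fan \<Sigma>"
    and "monoidal_complex \<Sigma> M"
    and "\<sigma> \<in> facets \<Sigma>"
    and "\<rho> \<in> diff_ops (semigroup_algebra (M \<sigma>)) i"
    and "b \<in> group_closure (M \<sigma>)"
    and "homogeneous_op (M \<sigma>) b \<rho>"
    and "\<forall>\<tau>\<in>facets \<Sigma> - {\<sigma>}. \<forall>f\<in>carrier (semigroup_algebra (M \<sigma>)).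
           toric_proj \<Sigma> M \<tau> f = 0 \<longrightarrow> semigroup_proj (M \<sigma>) (M (\<sigma> \<inter> \<tau>)) (\<rho> f) = 0"
  shows "\<exists>q :: ('n, 'k) mpoly.
    (\<forall>f\<in>carrier (semigroup_algebra (M \<sigma>)). \<rho> f = tpow b * theta_op q f) \<and>
    (\<forall>a\<in>M \<sigma>. a + b \<notin> M \<sigma> \<longrightarrow> mpoly_eval q a = 0) \<and>
    (\<forall>\<tau>\<in>facets \<Sigma> - {\<sigma>}. \<forall>a\<in>M \<sigma> - M (\<sigma> \<inter> \<tau>).
      a + b \<in> M (\<sigma> \<inter> \<tau>) \<longrightarrow> mpoly_eval q a = 0)"
proof -
  let ?A = "M \<sigma>"
  let ?S = "semigroup_algebra ?A :: ('k, ('n, 'k) laurent) module"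
  have \<sigma>: "\<sigma> \<in> \<Sigma>"
    using assms(3) by (simp add: facets_def)
  obtain G where G: "finite G" "?A = add_submonoid hull G"
    using monoidal_complexD(1)[OF assms(2) \<sigma>] by (auto simp only: fin_gen_monoid_def)
  have A: "add_submonoid ?A"
    unfolding G by (rule add_submonoid_hull)
  define c where "c = (\<lambda>a. Poly_Mapping.lookup (\<rho> (tpow a)) (a + b))"
  have "poly_on_lines ?A i c"
    unfolding c_def by (rule diff_ops_poly_on_lines[OF A assms(4)])
  then obtain F where F: "poly_fun F" "\<And>a. a \<in> ?A \<Longrightarrow> c a = F (\<lambda>j. of_int (a $ j))"
    using poly_on_lines_poly_fun[OF G(1)] unfolding G(2) by blast
  obtain q where "\<And>a. mpoly_eval q a = F (\<lambda>j. of_int (a $ j))"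
    using poly_fun_mpoly_eval[OF F(1)] by blast
  with F have q: "mpoly_eval q a = c a" if "a \<in> ?A" for a
    using that by simp
  \<comment> \<open>Homogeneity leaves only the exponent \<open>a + b\<close>, so \<open>c\<close>
    determines the operator on monomials.\<close>
  have \<rho>: "\<rho> (tpow a) = Poly_Mapping.single (a + b) (c a)" if a: "a \<in> ?A" for a
  proof -
    obtain r where "\<rho> (tpow a) = scale r (tpow (a + b))"
      using assms(6) a unfolding homogeneous_op_def by blast
    then show ?thesis
      by (intro poly_mapping_eqI) (simp add: c_def lookup_single when_def)
  qed
  have \<rho>_hom: "\<rho> \<in> Hom_scalar ?S"
    using diff_ops_subset_Hom_scalar[OF A] assms(4) by blast
  show ?thesis
  proof (intro exI[of _ q] conjI ballI impI)
    fix f assume "f \<in> carrier ?S"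
    then have f: "Poly_Mapping.keys f \<subseteq> ?A"
      by (simp add: semigroup_algebra_def)
    show "\<rho> f = tpow b * theta_op q f"
    proof (rule poly_mapping_eqI)
      fix x
      \<comment> \<open>Only the monomial with exponent \<open>x - b\<close> can contribute to the
        coefficient at \<open>x\<close>.\<close>
      define y where "y = x - b"
      have x: "x = b + y"
        by (simp add: y_def)
      have "Poly_Mapping.lookup (\<rho> f) x =
          (\<Sum>a\<in>Poly_Mapping.keys f. Poly_Mapping.lookup f a * Poly_Mapping.lookup (\<rho> (tpow a)) x)"
        by (simp add: Hom_scalar_expand[OF \<rho>_hom f] lookup_sum)
      also have "\<dots> = (\<Sum>a\<in>Poly_Mapping.keys f. if a = y then mpoly_eval q y * Poly_Mapping.lookup f y else 0)"
        using f by (intro sum.cong) (auto simp: \<rho> q x lookup_single when_def add.commute)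
      also have "\<dots> = mpoly_eval q y * Poly_Mapping.lookup f y"
        by (simp add: in_keys_iff)
      also have "\<dots> = Poly_Mapping.lookup (tpow b * theta_op q f) x"
        by (simp only: x lookup_tpow_mult lookup_theta_op)
      finally show "Poly_Mapping.lookup (\<rho> f) x = Poly_Mapping.lookup (tpow b * theta_op q f) x" .
    qed
  next
    fix a assume "a \<in> ?A" "a + b \<notin> ?A"
    then show "mpoly_eval q a = 0"
      using assms(6) by (simp add: q c_def homogeneous_op_def)
  next
    fix \<tau> a
    assume \<tau>: "\<tau> \<in> facets \<Sigma> - {\<sigma>}" and a: "a \<in> ?A - M (\<sigma> \<inter> \<tau>)" and ab: "a + b \<in> M (\<sigma> \<inter> \<tau>)"
    have \<tau>': "\<tau> \<in> \<Sigma>"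
      using \<tau> by (simp add: facets_def)
    have face: "\<sigma> \<inter> \<tau> \<in> \<Sigma>"
      using assms(1) \<sigma> \<tau>' unfolding rational_pointed_fan_def by blast
    \<comment> \<open>By the fan axioms the intersection is a cone of the fan, so its monoid is cut
      out of that of \<open>\<sigma>\<close>. A point \<open>a\<close> outside it is therefore not
      in \<open>M \<tau>\<close>, and the projection to \<open>\<tau>\<close> kills
      \<open>t^a\<close>.\<close>
    have M: "M (\<sigma> \<inter> \<tau>) = {a \<in> ?A. rvec a \<in> \<sigma> \<inter> \<tau>}"
      by (rule monoidal_complexD(3)[OF assms(2) \<sigma> face Int_lower1])
    have "rvec a \<in> \<sigma>"
      using monoidal_complexD(2)[OF assms(2) \<sigma>] a by blast
    moreover have "rvec a \<in> \<tau>" if "a \<in> M \<tau>"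
      using monoidal_complexD(2)[OF assms(2) \<tau>'] that by blast
    ultimately have "a \<notin> M \<tau>"
      using a M by blast
    moreover have carrier: "tpow a \<in> carrier ?S"
      using a by (simp add: semigroup_algebra_def)
    then have "tpow a \<in> carrier (toric_face_algebra \<Sigma> M :: ('k, ('n, 'k) laurent) module)"
      using semigroup_algebra_subset_toric_face_algebra[OF \<sigma>] by blast
    ultimately have "toric_proj \<Sigma> M \<tau> (tpow a :: ('n, 'k) laurent) = 0"
      by (simp add: toric_proj_def keep_single)
    then have "semigroup_proj ?A (M (\<sigma> \<inter> \<tau>)) (\<rho> (tpow a)) = 0"
      using assms(7) \<tau> carrier by blast
    moreover have "\<rho> (tpow a) \<in> carrier ?S"
      using \<rho>_hom carrier by (auto simp: Hom_scalar_def additive_on_def)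
    \<comment> \<open>The exponent \<open>a + b\<close> survives the projection to the intersection,
      so the projection of \<open>\<rho> (tpow a)\<close> is the whole image.\<close>
    ultimately have "Poly_Mapping.single (a + b) (c a) = 0"
      using a ab by (simp add: semigroup_proj_def \<rho> keep_single)
    then have "c a = 0"
      by (metis lookup_single_eq lookup_zero)
    then show "mpoly_eval q a = 0"
      using a q by simp
  qed
qed

end
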